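(* Let $h,f,\lambda>0$, $K\ge0$, and $q,V_1,V_2,V_3,V_4\in\mathbb{R}$. Let $\Xi=\{\xi=(\xi_1,\xi_2)\mid\xi_1+\xi_2=1,\ \xi_1,\xi_2\ge0\}$, $\tau(\xi)=(h/f)\sqrt{\xi_1^2+\xi_2^2}$, and $$V^{12}=\min_{\xi\in\Xi}\left\{\frac{(K+\lambda q)\tau(\xi)+(\xi_1V_1+\xi_2V_2)}{1+\lambda\tau(\xi)}\right\}.$$ Define $V^{23}$, $V^{34}$, $V^{41}$ in the same way using the pairs $(V_2,V_3)$, $(V_3,V_4)$, $(V_4,V_1)$ in place of $(V_1,V_2)$, and let $\mathcal{V}=\min(q,V^{12},V^{23},V^{34},V^{41})$. Let $\xi^*$ denote a minimizer in the definition of $V^{12}$ and suppose that $\mathcal{V}=V^{12}<q$. Then: 1. For $i=1,2$: $\xi_i^*>0$ implies $V^{12}>V_i$. 2. If $\xi_1^*>0$ and $\xi_2^*>0$, then $\mathcal{V}=V^{12}$ is also a solution of the quadratic equation $$f^2\left[\left(\frac{\mathcal{V}-V_1}{h}\right)^2+\left(\frac{\mathcal{V}-V_2}{h}\right)^2\right]=\left[K+\lambda q-\lambda\mathcal{V}\right]^2 .$$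
   Context: Here $\mathbf{x}$ is a gridpoint of a uniform Cartesian grid in $\mathbb{R}^2$ with spacing $h$, $V_1,V_2,V_3,V_4$ are the values of a grid function at its right, upper, left and lower neighbors, and $K,q,f$ are the running cost, terminal cost and speed at $\mathbf{x}$. $V^{12}$ is the first-quadrant semi-Lagrangian update for the isotropic problem with termination rate $\lambda$, and the quadratic equation is the upwind finite-difference discretization of $v=q+\frac1\lambda(K-f|\nabla v|)$ in the first quadrant. *)

theory Defs
  imports "HOL-Analysis.Analysis"
begin

definition Xi :: "(real ^ 2) set" where
  "Xi = {\<xi>. \<xi> $ 1 + \<xi> $ 2 = 1 \<and> \<xi> $ 1 \<ge> 0 \<and> \<xi> $ 2 \<ge> 0}"

definition tau :: "real \<Rightarrow> real \<Rightarrow> real ^ 2 \<Rightarrow> real" where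
  "tau h f \<xi> = (h / f) * sqrt ((\<xi> $ 1)\<^sup>2 + (\<xi> $ 2)\<^sup>2)"

text \<open>Here \<open>a\<close> and \<open>b\<close> are the values at the two neighbours spanning the quadrant;
  \<open>l\<close> is the termination rate.\<close>

definition sl_objective ::
  "real \<Rightarrow> real \<Rightarrow> real \<Rightarrow> real \<Rightarrow> real \<Rightarrow> real \<Rightarrow> real \<Rightarrow> real ^ 2 \<Rightarrow> real" where
  "sl_objective h f l K q a b \<xi> =
     ((K + l * q) * tau h f \<xi> + (\<xi> $ 1 * a + \<xi> $ 2 * b)) / (1 + l * tau h f \<xi>)"

text \<open>The minimum over \<^const>\<open>Xi\<close> is written as an infimum; it is attained for positive
  \<open>h\<close>, \<open>f\<close>, \<open>l\<close>, see \<open>sl_update_attained\<close>.\<close>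

definition sl_update ::
  "real \<Rightarrow> real \<Rightarrow> real \<Rightarrow> real \<Rightarrow> real \<Rightarrow> real \<Rightarrow> real \<Rightarrow> real" where
  "sl_update h f l K q a b = (INF \<xi>\<in>Xi. sl_objective h f l K q a b \<xi>)"

lemma compact_Xi: "compact Xi"
proof -
  have "closed Xi"
    unfolding Xi_def
    by (intro closed_Collect_conj closed_Collect_eq closed_Collect_le continuous_intros)
  moreover have "bounded Xi"
  proof (rule boundedI)
    fix x :: "real ^ 2" assume "x \<in> Xi"
    then show "norm x \<le> 1"
      using norm_le_l1_cart[of x] by (simp add: Xi_def sum_2)
  qed
  ultimately show ?thesis by (simp add: compact_eq_bounded_closed)
qed

lemma sl_update_attained:
  assumes "h > 0" "f > 0" "l > 0"
  shows "\<exists>\<xi>. is_arg_min (sl_objective h f l K q a b) (\<lambda>\<xi>. \<xi> \<in> Xi) \<xi>"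
    and "is_arg_min (sl_objective h f l K q a b) (\<lambda>\<xi>. \<xi> \<in> Xi) \<xi> \<Longrightarrow>
           sl_update h f l K q a b = sl_objective h f l K q a b \<xi>"
proof -
  have "0 \<le> tau h f x" for x
    using assms by (simp add: tau_def)
  then have "1 + l * tau h f x > 0" for x
    using assms(3) by (smt (verit) mult_nonneg_nonneg)
  then have nz: "1 + l * ((h / f) * sqrt ((x $ 1)\<^sup>2 + (x $ 2)\<^sup>2)) \<noteq> 0" for x :: "real ^ 2"
    unfolding tau_def by (metis less_irrefl)
  have "continuous_on Xi (sl_objective h f l K q a b)"
    unfolding sl_objective_def tau_def by (intro continuous_intros ballI nz) (use assms in auto)
  moreover have "axis 1 1 \<in> Xi" by (simp add: Xi_def axis_def)
  ultimately obtain x where "x \<in> Xi"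
    "\<And>y. y \<in> Xi \<Longrightarrow> sl_objective h f l K q a b x \<le> sl_objective h f l K q a b y"
    using continuous_attains_inf[OF compact_Xi] by blast
  then show "\<exists>\<xi>. is_arg_min (sl_objective h f l K q a b) (\<lambda>\<xi>. \<xi> \<in> Xi) \<xi>"
    unfolding is_arg_min_linorder by blast
  show "sl_update h f l K q a b = sl_objective h f l K q a b \<xi>"
    if "is_arg_min (sl_objective h f l K q a b) (\<lambda>\<xi>. \<xi> \<in> Xi) \<xi>"
    unfolding sl_update_def by (rule cInf_eq_minimum) (use that in \<open>auto simp: is_arg_min_linorder\<close>)
qed

end

theory Submission
  imports Defs
begin

text \<open>
  Clearing denominators, minimality of \<open>\<xi>\<close> with value \<open>m\<close> says that the linear form with
  coefficients \<open>m - V1\<close>, \<open>m - V2\<close> is bounded on the simplex by \<open>c\<close> times the Euclidean norm,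
  where \<open>c = (K + l * q - l * m) * (h / f)\<close>, with equality at \<open>\<xi>\<close>. By homogeneity the bound
  holds on the whole quadrant. At an interior point of equality, the Cauchy-Schwarz inequality
  at \<open>\<xi>\<close> and the bound at the coefficient vector itself force the norm of the coefficient
  vector to be \<open>c\<close>, which is the quadratic equation.
\<close>

text \<open>If \<open>a\<close> were nonpositive, the left side of \<open>eq\<close> would be at
  most \<open>b * y\<close>, hence at most \<open>c * y\<close>. But \<open>x > 0\<close> makes the
  norm of \<open>(x, y)\<close> strictly larger than \<open>y\<close>.\<close>

lemma support_coefficient_pos:
  fixes a b c x y :: real
  assumes "c > 0" and "b \<le> c" and "x > 0" and "y \<ge> 0"
    and eq: "a * x + b * y = c * sqrt (x\<^sup>2 + y\<^sup>2)"
  shows "a > 0"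
proof (rule ccontr)
  assume "\<not> a > 0"
  have "y = sqrt (y\<^sup>2)"
    using \<open>y \<ge> 0\<close> by simp
  also have "\<dots> < sqrt (x\<^sup>2 + y\<^sup>2)"
    using \<open>x > 0\<close> by (intro real_sqrt_less_mono) simp
  finally have "c * y < a * x + b * y"
    using eq \<open>c > 0\<close> by simp
  moreover have "a * x \<le> 0"
    using \<open>\<not> a > 0\<close> \<open>x > 0\<close> by (simp add: mult_nonpos_nonneg)
  moreover have "b * y \<le> c * y"
    using \<open>b \<le> c\<close> \<open>y \<ge> 0\<close> by (rule mult_right_mono)
  ultimately show False
    by linarith
qed

text \<open>The premise \<open>bound\<close> is the quadrant bound evaluated at
  \<open>(a, b)\<close> itself; it yields norm at most \<open>c\<close>. Cauchy-Schwarz in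
  \<open>eq\<close> yields the converse.\<close>

lemma support_norm_eq:
  fixes a b c x y :: real
  assumes "c > 0" and "x > 0"
    and bound: "a * a + b * b \<le> c * sqrt (a\<^sup>2 + b\<^sup>2)"
    and eq: "a * x + b * y = c * sqrt (x\<^sup>2 + y\<^sup>2)"
  shows "a\<^sup>2 + b\<^sup>2 = c\<^sup>2"
proof (rule antisym)
  define r where "r = sqrt (a\<^sup>2 + b\<^sup>2)"
  have "r \<ge> 0" and "r * r = a * a + b * b"
    by (simp_all add: r_def power2_eq_square)
  then have "r \<le> c"
    using bound \<open>c > 0\<close> unfolding r_def[symmetric]
    by (cases "r = 0") (simp_all flip: \<open>r * r = a * a + b * b\<close>)
  then have "sqrt (a\<^sup>2 + b\<^sup>2) \<le> c"
    by (simp add: r_def)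
  then show "a\<^sup>2 + b\<^sup>2 \<le> c\<^sup>2"
    by (rule sqrt_le_D)
next
  \<comment> \<open>Lagrange's identity; dropping the last square leaves Cauchy-Schwarz.\<close>
  have "(a\<^sup>2 + b\<^sup>2) * (x\<^sup>2 + y\<^sup>2) = (a * x + b * y)\<^sup>2 + (a * y - b * x)\<^sup>2"
    by algebra
  then have "(a * x + b * y)\<^sup>2 \<le> (a\<^sup>2 + b\<^sup>2) * (x\<^sup>2 + y\<^sup>2)"
    by simp
  then have "c\<^sup>2 * (x\<^sup>2 + y\<^sup>2) \<le> (a\<^sup>2 + b\<^sup>2) * (x\<^sup>2 + y\<^sup>2)"
    unfolding eq by (simp add: power_mult_distrib)
  moreover have "x\<^sup>2 + y\<^sup>2 > 0"
    using \<open>x > 0\<close> by (simp add: add_pos_nonneg)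
  ultimately show "c\<^sup>2 \<le> a\<^sup>2 + b\<^sup>2"
    by simp
qed

text \<open>Multiply by the positive denominator \<open>1 + l * t\<close>. Since the coordinates of
  \<open>\<xi>\<close> sum to 1, the bare \<open>m\<close> splits as
  \<open>m * \<xi> $ 1 + m * \<xi> $ 2\<close> and joins the linear form.\<close>

lemma sl_objective_ge_iff:
  fixes h f l K q a b m :: real and \<xi> :: "real ^ 2"
  assumes "h > 0" and "f > 0" and "l > 0" and "\<xi> \<in> Xi"
  shows "m \<le> sl_objective h f l K q a b \<xi> \<longleftrightarrow>
           (m - a) * \<xi> $ 1 + (m - b) * \<xi> $ 2
             \<le> (K + l * q - l * m) * (h / f) * sqrt ((\<xi> $ 1)\<^sup>2 + (\<xi> $ 2)\<^sup>2)" (is ?ge)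
    and "m = sl_objective h f l K q a b \<xi> \<longleftrightarrow>
           (m - a) * \<xi> $ 1 + (m - b) * \<xi> $ 2
             = (K + l * q - l * m) * (h / f) * sqrt ((\<xi> $ 1)\<^sup>2 + (\<xi> $ 2)\<^sup>2)" (is ?eq)
proof -
  define t where "t = tau h f \<xi>"
  have "t \<ge> 0"
    using assms by (simp add: t_def tau_def)
  then have pos: "1 + l * t > 0"
    using \<open>l > 0\<close> by (simp add: add_pos_nonneg)
  have t: "(K + l * q - l * m) * (h / f) * sqrt ((\<xi> $ 1)\<^sup>2 + (\<xi> $ 2)\<^sup>2) = (K + l * q - l * m) * t"
    by (simp add: t_def tau_def)
  have \<xi>2: "\<xi> $ 2 = 1 - \<xi> $ 1"
    using \<open>\<xi> \<in> Xi\<close> by (simp add: Xi_def)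
  have diff: "(K + l * q) * t + (\<xi> $ 1 * a + \<xi> $ 2 * b) - m * (1 + l * t)
      = (K + l * q - l * m) * t - ((m - a) * \<xi> $ 1 + (m - b) * \<xi> $ 2)"
    unfolding \<xi>2 by (simp add: algebra_simps)
  show ?ge
    unfolding sl_objective_def t t_def[symmetric] pos_le_divide_eq[OF pos] using diff by linarith
  have "m = sl_objective h f l K q a b \<xi> \<longleftrightarrow>
      m * (1 + l * t) = (K + l * q) * t + (\<xi> $ 1 * a + \<xi> $ 2 * b)"
    unfolding sl_objective_def t_def[symmetric] using pos by (intro nonzero_eq_divide_eq) simp
  then show ?eq
    unfolding t using diff by linarith
qed

text \<open>Both sides are positively homogeneous of degree 1, so a nonzero point is scaled by
  \<open>1 / (x + y)\<close> onto the simplex, where minimality applies.\<close>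

lemma sl_update_bound_quadrant:
  fixes h f l K q a b x y :: real
  defines "m \<equiv> sl_update h f l K q a b"
  assumes "h > 0" and "f > 0" and "l > 0" and "x \<ge> 0" and "y \<ge> 0"
  shows "(m - a) * x + (m - b) * y \<le> (K + l * q - l * m) * (h / f) * sqrt (x\<^sup>2 + y\<^sup>2)"
proof (cases "x + y = 0")
  case True
  then have "x = 0" "y = 0"
    using \<open>x \<ge> 0\<close> \<open>y \<ge> 0\<close> by auto
  then show ?thesis
    by simp
next
  case False
  define s where "s = x + y"
  have "s > 0"
    using False \<open>x \<ge> 0\<close> \<open>y \<ge> 0\<close> by (simp add: s_def)
  let ?\<zeta> = "vector [x / s, y / s] :: real ^ 2"
  let ?c = "(K + l * q - l * m) * (h / f)"
  have mem: "?\<zeta> \<in> Xi"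
    using \<open>s > 0\<close> \<open>x \<ge> 0\<close> \<open>y \<ge> 0\<close>
    by (simp add: Xi_def add_divide_distrib[symmetric] flip: s_def)
  obtain \<xi> where "is_arg_min (sl_objective h f l K q a b) (\<lambda>\<xi>. \<xi> \<in> Xi) \<xi>"
    using sl_update_attained(1) assms by blast
  then have "m \<le> sl_objective h f l K q a b ?\<zeta>"
    using sl_update_attained(2) assms mem by (fastforce simp: is_arg_min_linorder)
  then have "(m - a) * (x / s) + (m - b) * (y / s) \<le> ?c * sqrt ((x / s)\<^sup>2 + (y / s)\<^sup>2)"
    using sl_objective_ge_iff(1)[OF \<open>h > 0\<close> \<open>f > 0\<close> \<open>l > 0\<close> mem] by simp
  also have "sqrt ((x / s)\<^sup>2 + (y / s)\<^sup>2) = sqrt (x\<^sup>2 + y\<^sup>2) / s"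
    using \<open>s > 0\<close> by (simp add: power_divide add_divide_distrib[symmetric] real_sqrt_divide)
  finally have "((m - a) * x + (m - b) * y) / s \<le> (?c * sqrt (x\<^sup>2 + y\<^sup>2)) / s"
    by (simp add: add_divide_distrib)
  then show ?thesis
    using \<open>s > 0\<close> by (simp only: divide_le_cancel)
qed

theorem theorem7p2:
  fixes h f l K q V1 V2 V3 V4 V12 V23 V34 V41 V :: real
    and \<xi> :: "real ^ 2"
  assumes "h > 0" and "f > 0" and "l > 0" and "K \<ge> 0"
    and "V12 = sl_update h f l K q V1 V2"
    and "V23 = sl_update h f l K q V2 V3"
    and "V34 = sl_update h f l K q V3 V4"
    and "V41 = sl_update h f l K q V4 V1"
    and "V = Min {q, V12, V23, V34, V41}"
    and "is_arg_min (sl_objective h f l K q V1 V2) (\<lambda>\<xi>. \<xi> \<in> Xi) \<xi>"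
    and "V = V12" and "V12 < q"
  shows "((\<xi> $ 1 > 0 \<longrightarrow> V12 > V1) \<and> (\<xi> $ 2 > 0 \<longrightarrow> V12 > V2)) \<and>
    (\<xi> $ 1 > 0 \<and> \<xi> $ 2 > 0 \<longrightarrow>
      f\<^sup>2 * (((V - V1) / h)\<^sup>2 + ((V - V2) / h)\<^sup>2) = (K + l * q - l * V)\<^sup>2)"
proof -
  define c where "c = (K + l * q - l * V12) * (h / f)"
  \<comment> \<open>The hypothesis \<open>V12 < q\<close> enters here: it makes the constant
    \<open>c\<close> strictly positive.\<close>
  have "K + l * q - l * V12 > 0"
    using mult_strict_left_mono[OF \<open>V12 < q\<close> \<open>l > 0\<close>] \<open>K \<ge> 0\<close> by linarith
  then have "c > 0"
    using \<open>h > 0\<close> \<open>f > 0\<close> by (simp add: c_def)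
  have mem: "\<xi> \<in> Xi"
    using assms(10) by (simp add: is_arg_min_linorder)
  then have nonneg: "\<xi> $ 1 \<ge> 0" "\<xi> $ 2 \<ge> 0"
    by (simp_all add: Xi_def)
  have bound: "(V12 - V1) * x + (V12 - V2) * y \<le> c * sqrt (x\<^sup>2 + y\<^sup>2)" if "x \<ge> 0" "y \<ge> 0" for x y
    using sl_update_bound_quadrant[OF assms(1-3) that] by (simp add: c_def assms(5))
  have "V12 = sl_objective h f l K q V1 V2 \<xi>"
    using sl_update_attained(2)[OF assms(1-3,10)] assms(5) by simp
  then have eq: "(V12 - V1) * \<xi> $ 1 + (V12 - V2) * \<xi> $ 2 = c * sqrt ((\<xi> $ 1)\<^sup>2 + (\<xi> $ 2)\<^sup>2)"
    using sl_objective_ge_iff(2)[OF assms(1-3) mem] by (simp add: c_def)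
  \<comment> \<open>The bound at the unit vector \<open>(0, 1)\<close> reads
    \<open>V12 - V2 \<le> c\<close>, the premise on the other coefficient.\<close>
  have gt1: "V12 > V1" if "\<xi> $ 1 > 0"
    using support_coefficient_pos[OF \<open>c > 0\<close> _ that nonneg(2) eq] bound[of 0 1] by simp
  have gt2: "V12 > V2" if "\<xi> $ 2 > 0"
    using support_coefficient_pos[OF \<open>c > 0\<close> _ that nonneg(1), of "V12 - V1" "V12 - V2"]
      eq bound[of 1 0] by (simp add: add.commute)
  have "f\<^sup>2 * (((V - V1) / h)\<^sup>2 + ((V - V2) / h)\<^sup>2) = (K + l * q - l * V)\<^sup>2"
    if "\<xi> $ 1 > 0" "\<xi> $ 2 > 0"
  proof -
    \<comment> \<open>By \<open>gt1\<close> and \<open>gt2\<close> the coefficient vector lies in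
      the quadrant, so \<open>bound\<close> may be applied to it.\<close>
    have "(V12 - V1)\<^sup>2 + (V12 - V2)\<^sup>2 = c\<^sup>2"
      by (rule support_norm_eq[OF \<open>c > 0\<close> that(1) bound eq])
        (use gt1[OF that(1)] gt2[OF that(2)] in simp_all)
    \<comment> \<open>The factor \<open>f / h\<close> cancels the \<open>h / f\<close> contained in
      \<open>c\<close>.\<close>
    moreover have "f\<^sup>2 * (((V - V1) / h)\<^sup>2 + ((V - V2) / h)\<^sup>2)
        = ((V12 - V1)\<^sup>2 + (V12 - V2)\<^sup>2) * (f / h)\<^sup>2"
      using \<open>V = V12\<close> by (simp add: power_divide add_divide_distrib algebra_simps)
    ultimately show ?thesis
      using \<open>h > 0\<close> \<open>f > 0\<close> \<open>V = V12\<close> by (simp add: c_def power_divide power_mult_distrib)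
  qed
  then show ?thesis
    using gt1 gt2 by blast
qed

end
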